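(* For complex $|x|<1$ write \[ \prod_{n=1}^{\infty} (1+x^n)^4 (1+x^{2n})^2 (1+x^{4n})^4 = \sum_{n=0}^{\infty} \alpha(n) x^n . \] Then $\alpha(n) > 0$ for all $n\in\mathbb{N}_0=\{0,1,2,\dots\}$. *)

theory Defs
  imports "HOL-Analysis.Analysis"
begin

definition factor :: "complex \<Rightarrow> nat \<Rightarrow> complex" where
  "factor x n = (1 + x ^ n) ^ 4 * (1 + x ^ (2 * n)) ^ 2 * (1 + x ^ (4 * n)) ^ 4"

(* prodinf ranges over k = 0, 1, 2, ..., hence the shift n = Suc k. *)
definition generating_product :: "complex \<Rightarrow> complex" where
  "generating_product x = (\<Prod>k. factor x (Suc k))"

definition is_expansion :: "(nat \<Rightarrow> complex) \<Rightarrow> bool" where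
  "is_expansion \<alpha> \<longleftrightarrow>
     (\<forall>x. norm x < 1 \<longrightarrow> (\<lambda>n. \<alpha> n * x ^ n) sums generating_product x)"

end

theory Submission
  imports Defs "HOL-Complex_Analysis.Complex_Analysis" "HOL-Library.Complex_Order"
begin

text \<open>
  Every factor is \<open>1 + x ^ n\<close> times a polynomial with nonnegative coefficients and constant
  term 1, so the \<open>n\<close>-th coefficient of each partial product is at least 1 as soon as the factor
  with index \<open>n\<close> is included. The partial products converge locally uniformly on the unit disc,
  so their Taylor coefficients at 0 converge to those of the infinite product.
\<close>

subsection \<open>Local uniform convergence\<close>

text \<open>Expand \<open>p * q - 1\<close> in terms of \<open>p - 1\<close> and
  \<open>q - 1\<close>. The bounds \<open>(1 + t) ^ m - 1\<close> satisfy the same identity, so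
  bounds of this shape pass to products with the exponents adding up.\<close>

lemma norm_mult_minus_one_le:
  fixes p q :: "'a::real_normed_algebra_1"
  assumes "norm (p - 1) \<le> (1 + t) ^ m - 1" "norm (q - 1) \<le> (1 + t) ^ n - 1"
  shows "norm (p * q - 1) \<le> (1 + t) ^ (m + n) - (1::real)"
proof -
  have "p * q - 1 = (p - 1) * (q - 1) + (p - 1) + (q - 1)"
    by (simp add: algebra_simps)
  also have "norm \<dots> \<le> norm (p - 1) * norm (q - 1) + norm (p - 1) + norm (q - 1)"
    by (intro norm_triangle_mono norm_mult_ineq order_refl)
  also have "\<dots> \<le> ((1 + t) ^ m - 1) * ((1 + t) ^ n - 1) + ((1 + t) ^ m - 1) + ((1 + t) ^ n - 1)"
    using assms order_trans[OF norm_ge_zero assms(1)]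
    by (intro add_mono mult_mono order_refl norm_ge_zero)
  also have "\<dots> = (1 + t) ^ (m + n) - 1"
    by (simp add: algebra_simps power_add)
  finally show ?thesis .
qed

lemma norm_power_minus_one_le:
  fixes u :: "'a::real_normed_algebra_1"
  assumes "norm u \<le> t"
  shows "norm ((1 + u) ^ n - 1) \<le> (1 + t) ^ n - (1::real)"
proof (induction n)
  case (Suc n)
  then show ?case
    using norm_mult_minus_one_le[of "1 + u" t 1 "(1 + u) ^ n" n] assms by simp
qed simp

text \<open>The factor is a product of 4 + 2 + 4 = 10 terms \<open>1 + u\<close> with
  \<open>norm u \<le> r ^ n\<close>. Since \<open>r ^ n \<le> 1\<close>, the geometric sum for
  \<open>(1 + r ^ n) ^ 10 - 1\<close> leaves \<open>r ^ n\<close> times 2^10 - 1 = 1023.\<close>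

lemma norm_factor_minus_one_le:
  assumes "norm z \<le> r" "r < 1"
  shows "norm (factor z n - 1) \<le> 1023 * r ^ n"
proof -
  have r: "0 \<le> r"
    using assms(1) norm_ge_zero order_trans by blast
  have t: "0 \<le> r ^ n" "r ^ n \<le> 1"
    using r assms(2) by (auto intro: power_le_one)
  have pow: "norm (z ^ (k * n)) \<le> r ^ n" if "k \<ge> 1" for k
  proof -
    have "norm (z ^ (k * n)) \<le> r ^ (k * n)"
      using assms(1) by (simp add: norm_power power_mono)
    also have "\<dots> \<le> r ^ n"
      using r assms(2) that by (intro power_decreasing) auto
    finally show ?thesis .
  qed
  have "norm (factor z n - 1) \<le> (1 + r ^ n) ^ (4 + 2 + 4) - 1"
    unfolding factor_def
    using pow[of 1] pow[of 2] pow[of 4]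
    by (intro norm_mult_minus_one_le norm_power_minus_one_le) auto
  also have "\<dots> = r ^ n * (\<Sum>i<10. (1 + r ^ n) ^ i)"
    using power_diff_1_eq[of "1 + r ^ n" 10] by simp
  also have "\<dots> \<le> r ^ n * (\<Sum>i<10. 2 ^ i)"
    using t by (intro mult_left_mono sum_mono power_mono) auto
  also have "(\<Sum>i<10. 2 ^ i) = (1023::real)"
    by (simp add: eval_nat_numeral)
  finally show ?thesis
    by (simp add: mult.commute)
qed

lemma summable_factor_bound:
  fixes r :: real
  assumes "0 \<le> r" "r < 1"
  shows "summable (\<lambda>n. 1023 * r ^ Suc n)"
  using assms by (intro summable_mult) (simp add: summable_geometric summable_Suc_iff)

lemma convergent_prod_factor:
  assumes "norm x < 1"
  shows "convergent_prod (\<lambda>k. factor x (Suc k))"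
proof -
  have "summable (\<lambda>k. norm (factor x (Suc k) - 1))"
    by (rule summable_comparison_test'[OF summable_factor_bound[OF norm_ge_zero assms], of 0])
       (simp del: power_Suc add: norm_factor_minus_one_le[OF order_refl assms])
  then show ?thesis
    using abs_convergent_prod_conv_summable abs_convergent_prod_imp_convergent_prod by blast
qed

lemma uniform_limit_generating_product:
  assumes "r < 1"
  shows "uniform_limit (cball 0 r) (\<lambda>N x. \<Prod>k<N. factor x (Suc k)) generating_product sequentially"
proof (cases "0 \<le> r")
  case True
  have "uniformly_convergent_on (cball 0 r) (\<lambda>N x. \<Prod>k<N. factor x (Suc k))"
  proof (rule uniformly_convergent_on_prod')
    show "continuous_on (cball 0 r) (\<lambda>x. factor x (Suc n))" for n
      unfolding factor_def by (intro continuous_intros)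
    show "uniformly_convergent_on (cball 0 r) (\<lambda>N x. \<Sum>n<N. norm (factor x (Suc n) - 1))"
      by (rule Weierstrass_m_test'[OF _ summable_factor_bound[OF True assms]])
         (simp del: power_Suc add: norm_factor_minus_one_le[OF _ assms])
  qed auto
  then obtain g where
    g: "uniform_limit (cball 0 r) (\<lambda>N x. \<Prod>k<N. factor x (Suc k)) g sequentially"
    unfolding uniformly_convergent_on_def by blast
  \<comment> \<open>So far \<open>g\<close> is just some uniform limit. Convergence of the product
    at each point makes the value of \<open>generating_product\<close> the limit of the same partial
    products.\<close>
  have "g x = generating_product x" if "x \<in> cball 0 r" for x
  proof (rule LIMSEQ_unique)
    show "(\<lambda>N. \<Prod>k<N. factor x (Suc k)) \<longlonglongrightarrow> g x"
      using tendsto_uniform_limitI[OF g that] .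
    have "norm x < 1"
      using that assms by simp
    then show "(\<lambda>N. \<Prod>k<N. factor x (Suc k)) \<longlonglongrightarrow> generating_product x"
      unfolding generating_product_def
      using has_prod_imp_tendsto' convergent_prod_factor by blast
  qed
  then show ?thesis
    using uniform_limit_cong'[THEN iffD1, OF _ _ g] by simp
qed (simp add: cball_empty)

lemma holomorphic_partial_product: "(\<lambda>x. \<Prod>k<N. factor x (Suc k)) holomorphic_on A"
  unfolding factor_def by (intro holomorphic_intros)

lemma holomorphic_generating_product: "generating_product holomorphic_on ball 0 1"
proof (rule holomorphic_uniform_sequence[OF open_ball holomorphic_partial_product])
  fix x :: complex assume x: "x \<in> ball 0 1"
  \<comment> \<open>Half the distance from \<open>x\<close> to the unit circle, so that the disc
    around \<open>x\<close> lies in a centred disc of radius below 1.\<close>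
  define d where "d = (1 - norm x) / 2"
  have sub: "cball x d \<subseteq> cball 0 (norm x + d)"
    by (simp add: subset_iff) (metis add.commute add_le_cancel_left dist_norm norm_minus_commute norm_triangle_sub order_trans)
  have less: "norm x + d < 1" and d: "0 < d"
    using x by (auto simp: d_def field_simps)
  moreover have "cball x d \<subseteq> ball 0 1"
    using sub less by force
  ultimately show "\<exists>d>0. cball x d \<subseteq> ball 0 1 \<and>
      uniform_limit (cball x d) (\<lambda>N x. \<Prod>k<N. factor x (Suc k)) generating_product sequentially"
    using uniform_limit_on_subset[OF uniform_limit_generating_product[OF less] sub] by blast
qed

subsection \<open>Coefficients of the partial products\<close>

lemma fps_mult_nth_nonneg:
  fixes F G :: "'a::ordered_comm_ring fps"
  assumes "\<And>n. 0 \<le> F $ n" "\<And>n. 0 \<le> G $ n"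
  shows "0 \<le> (F * G) $ n"
  unfolding fps_mult_nth using assms by (intro sum_nonneg mult_nonneg_nonneg)

text \<open>The left-hand side is a single summand of the Cauchy product, and the other summands are
  nonnegative.\<close>

lemma fps_mult_nth_ge:
  fixes F G :: "'a::{ordered_comm_ring, ring_1} fps"
  assumes "\<And>n. 0 \<le> F $ n" "\<And>n. 0 \<le> G $ n"
  shows "F $ i * G $ j \<le> (F * G) $ (i + j)"
proof -
  have "F $ i * G $ (i + j - i) \<le> (\<Sum>k=0..i + j. F $ k * G $ (i + j - k))"
    using assms by (intro member_le_sum) auto
  then show ?thesis
    by (simp add: fps_mult_nth)
qed

text \<open>The order on the complex numbers compares real parts and demands equal imaginary parts.
  Thus \<open>0 \<le> c\<close> or \<open>1 \<le> c\<close> also records that \<open>c\<close> is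
  real.\<close>

lemma zero_le_one_complex: "0 \<le> (1::complex)"
  by (simp add: less_eq_complex_def)

lemma fps_power_nth_nonneg:
  fixes F :: "complex fps"
  assumes "\<And>n. 0 \<le> F $ n"
  shows "0 \<le> (F ^ m) $ n"
  using assms by (induction m arbitrary: n) (auto intro: fps_mult_nth_nonneg simp: zero_le_one_complex)

lemma one_plus_fps_X_power_nth_nonneg: "0 \<le> (1 + fps_X ^ m :: complex fps) $ n"
  using zero_le_one_complex by (auto simp: fps_X_power_nth intro: add_nonneg_nonneg)

definition factor_fps :: "nat \<Rightarrow> complex fps" where
  "factor_fps n = (1 + fps_X ^ n) ^ 4 * (1 + fps_X ^ (2 * n)) ^ 2 * (1 + fps_X ^ (4 * n)) ^ 4"

lemma factor_has_fps_expansion: "(\<lambda>x. factor x n) has_fps_expansion factor_fps n"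
  unfolding factor_def factor_fps_def by (intro fps_expansion_intros)

lemma factor_fps_nth_nonneg: "0 \<le> factor_fps n $ i"
  unfolding factor_fps_def
  by (intro fps_mult_nth_nonneg fps_power_nth_nonneg one_plus_fps_X_power_nth_nonneg)

lemma factor_fps_nth_0: "n > 0 \<Longrightarrow> factor_fps n $ 0 = 1"
  by (simp add: factor_fps_def fps_power_zeroth power_0_left)

lemma factor_fps_nth_self:
  assumes "n > 0"
  shows "1 \<le> factor_fps n $ n"
proof -
  \<comment> \<open>One of the four copies of \<open>1 + fps_X ^ n\<close> is split off; its
    coefficient 1 at \<open>n\<close> meets the constant term 1 of \<open>G\<close>.\<close>
  define G :: "complex fps"
    where "G = (1 + fps_X ^ n) ^ 3 * (1 + fps_X ^ (2 * n)) ^ 2 * (1 + fps_X ^ (4 * n)) ^ 4"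
  have "factor_fps n = (1 + fps_X ^ n) * G"
    by (simp add: factor_fps_def G_def eval_nat_numeral mult.assoc)
  moreover have "0 \<le> G $ i" for i
    unfolding G_def
    by (intro fps_mult_nth_nonneg fps_power_nth_nonneg one_plus_fps_X_power_nth_nonneg)
  moreover have "G $ 0 = 1"
    using assms by (simp add: G_def fps_power_zeroth power_0_left)
  ultimately show ?thesis
    using fps_mult_nth_ge[of "1 + fps_X ^ n" G n 0] one_plus_fps_X_power_nth_nonneg assms
    by (simp add: fps_X_power_nth)
qed

lemma prod_factor_fps_nth_nonneg: "0 \<le> (\<Prod>k<N. factor_fps (Suc k)) $ n"
  by (induction N arbitrary: n)
     (auto intro: fps_mult_nth_nonneg factor_fps_nth_nonneg simp: zero_le_one_complex)

text \<open>Induction on the number of factors. Old coefficients survive because the new factor has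
  constant term 1; the coefficient at \<open>Suc N\<close> comes from the new factor, multiplied by
  the constant term 1 of the old product.\<close>

lemma prod_factor_fps_nth_ge_one:
  "n \<le> N \<Longrightarrow> 1 \<le> (\<Prod>k<N. factor_fps (Suc k)) $ n"
proof (induction N arbitrary: n)
  case (Suc N)
  let ?P = "\<Prod>k<N. factor_fps (Suc k)"
  have ge: "?P $ i * factor_fps (Suc N) $ j \<le> (\<Prod>k<Suc N. factor_fps (Suc k)) $ (i + j)" for i j
    using fps_mult_nth_ge[OF prod_factor_fps_nth_nonneg factor_fps_nth_nonneg] by simp
  show ?case
  proof (cases "n \<le> N")
    case True
    then show ?thesis
      using order_trans[OF Suc.IH[OF True]] ge[of n 0] by (simp add: factor_fps_nth_0)
  next
    case False
    then have n: "n = Suc N"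
      using Suc.prems by simp
    have "?P $ 0 = 1"
      by (induction N) (simp_all add: factor_fps_nth_0)
    then show ?thesis
      using order_trans[OF factor_fps_nth_self[of n]] ge[of 0 n] n by simp
  qed
qed simp

subsection \<open>Coefficients of the infinite product\<close>

text \<open>Locally uniform convergence of holomorphic functions carries over to derivatives at 0,
  hence to coefficients. The uniform bound 1 survives the limit, where mere positivity could
  degenerate to 0.\<close>

lemma taylor_coeff_generating_product_ge_one:
  "1 \<le> (deriv ^^ n) generating_product 0 / fact n"
proof -
  define a where "a = (\<lambda>N. (\<Prod>k<N. factor_fps (Suc k)) $ n)"
  have "a N = (deriv ^^ n) (\<lambda>x. \<Prod>k<N. factor x (Suc k)) 0 / fact n" for N
    unfolding a_def
    by (intro fps_nth_fps_expansion has_fps_expansion_prod factor_has_fps_expansion)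
  then have "a = (\<lambda>N. (deriv ^^ n) (\<lambda>x. \<Prod>k<N. factor x (Suc k)) 0 / fact n)"
    by (rule ext)
  moreover have "(\<lambda>N. (deriv ^^ n) (\<lambda>x. \<Prod>k<N. factor x (Suc k)) 0)
      \<longlonglongrightarrow> (deriv ^^ n) generating_product 0"
  proof (rule higher_deriv_complex_uniform_limit)
    show "uniform_limit (ball 0 (1/2)) (\<lambda>N x. \<Prod>k<N. factor x (Suc k)) generating_product sequentially"
      by (rule uniform_limit_on_subset[OF uniform_limit_generating_product[of "1/2"]]) auto
  qed (simp_all add: holomorphic_partial_product)
  ultimately have lim: "a \<longlonglongrightarrow> (deriv ^^ n) generating_product 0 / fact n"
    by (auto intro: tendsto_divide)
  have ge: "1 \<le> a N" if "N \<ge> n" for N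
    using prod_factor_fps_nth_ge_one[OF that] by (simp add: a_def)
  \<comment> \<open>The limit is taken separately in real and imaginary parts;
    \<open>1 \<le> a N\<close> makes \<open>Im (a N)\<close> vanish once
    \<open>N \<ge> n\<close>.\<close>
  have "1 \<le> Re ((deriv ^^ n) generating_product 0 / fact n)"
    by (rule LIMSEQ_le_const[OF tendsto_Re[OF lim]]) (use ge in \<open>auto simp: less_eq_complex_def\<close>)
  moreover have "Im ((deriv ^^ n) generating_product 0 / fact n) = 0"
  proof (rule LIMSEQ_unique[OF tendsto_Im[OF lim]])
    show "(\<lambda>N. Im (a N)) \<longlonglongrightarrow> 0"
      by (rule tendsto_eventually)
         (use ge in \<open>auto simp: less_eq_complex_def eventually_at_top_linorder\<close>)
  qed
  ultimately show ?thesis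
    by (simp add: less_eq_complex_def)
qed

section \<open>Existence and uniqueness of the expansion\<close>

lemma is_expansion_taylor: "is_expansion (\<lambda>n. (deriv ^^ n) generating_product 0 / fact n)"
  using holomorphic_power_series[OF holomorphic_generating_product] by (simp add: is_expansion_def)

text \<open>A power series that represents the function near 0 is its Taylor series. This gives
  uniqueness and transfers the coefficient bound to every expansion.\<close>

lemma is_expansion_imp_taylor:
  assumes "is_expansion \<alpha>"
  shows "\<alpha> n = (deriv ^^ n) generating_product 0 / fact n"
proof -
  have sums: "(\<lambda>n. Abs_fps \<alpha> $ n * x ^ n) sums generating_product x" if "norm x < 1" for x
    using assms that by (simp add: is_expansion_def)
  have "generating_product has_fps_expansion Abs_fps \<alpha>"
    unfolding has_fps_expansion_def
  proof
    \<comment> \<open>Convergence at a single nonzero point, here 1/2, bounds the radius from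
      below.\<close>
    have "norm (1/2 :: complex) \<le> fps_conv_radius (Abs_fps \<alpha>)"
      unfolding fps_conv_radius_def
      by (rule conv_radius_geI) (use sums[of "1/2"] in \<open>auto intro: sums_summable\<close>)
    then show "0 < fps_conv_radius (Abs_fps \<alpha>)"
      by (rule less_le_trans[rotated]) simp
    have "eventually (\<lambda>z::complex. z \<in> ball 0 1) (nhds 0)"
      by (intro eventually_nhds_in_open) auto
    then show "eventually (\<lambda>z. eval_fps (Abs_fps \<alpha>) z = generating_product z) (nhds 0)"
      by eventually_elim (simp only: eval_fps_def sums_unique[OF sums, symmetric] mem_ball_0)
  qed
  from fps_nth_fps_expansion[OF this] show ?thesis
    by simp
qed

theorem theorem5p3:
  "(\<forall>x::complex. norm x < 1 \<longrightarrow> convergent_prod (\<lambda>k. factor x (Suc k))) \<and>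
   (\<exists>!\<alpha>. is_expansion \<alpha>) \<and>
   (\<forall>\<alpha>. is_expansion \<alpha> \<longrightarrow> (\<forall>n. \<alpha> n \<in> \<real> \<and> 0 < Re (\<alpha> n)))"
proof (intro conjI allI impI)
  show "\<exists>!\<alpha>. is_expansion \<alpha>"
    using is_expansion_taylor is_expansion_imp_taylor by (intro ex1I) blast+
  fix \<alpha> n assume "is_expansion \<alpha>"
  then have "1 \<le> \<alpha> n"
    using is_expansion_imp_taylor taylor_coeff_generating_product_ge_one by simp
  then show "\<alpha> n \<in> \<real>" "0 < Re (\<alpha> n)"
    by (auto simp: less_eq_complex_def complex_is_Real_iff)
qed (rule convergent_prod_factor)

end
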